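(* Let $n,m\ge1$ be integers, let $\rho$ be a $2^n\times2^n$ density matrix with eigenvalues $\lambda_1(\rho)\ge\lambda_2(\rho)\ge\dots\ge\lambda_{2^n}(\rho)$, and let $\hat\rho$ be the linear estimator of $\rho$ built from $m$ independent repetitions of each of the $3^n$ Pauli measurements. For a real number $\nu>0$ let $$\hat\rho_\nu=\arg\min_R\left[\|R-\hat\rho\|_F^2+\nu\cdot\mathrm{rank}(R)\right],$$ where the minimum is over all $2^n\times 2^n$ Hermitian matrices $R$. For any $\theta>0$ put $c(\theta)=1+2/\theta$. Then, on the event $\{\nu\ge(1+\theta)\|\hat\rho-\rho\|^2\}$, we have $$\|\hat\rho_\nu-\rho\|_F^2\le\min_{k\in\{1,\dots,2^n\}}\left\{c^2(\theta)\sum_{j>k}\lambda_j^2(\rho)+2c(\theta)\nu k\right\}.$$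
   Context: A $2^n\times 2^n$ density matrix is a complex Hermitian positive semidefinite matrix $\rho$ with $\mathrm{Tr}(\rho)=1$. Let $\sigma_x,\sigma_y,\sigma_z$ be the $2\times2$ Pauli matrices and $\sigma_I=I$ the $2\times 2$ identity. Put $\mathcal E^n=\{x,y,z\}^n$, $\mathcal R^n=\{-1,1\}^n$, $\mathcal M^n=\{I,x,y,z\}^n$. For $\mathbf b\in\mathcal M^n$ set $\sigma_{\mathbf b}=\sigma_{b_1}\otimes\cdots\otimes\sigma_{b_n}$, $E_{\mathbf b}=\{j: b_j=I\}$, and let $d(\mathbf b)$ be the cardinality of $E_{\mathbf b}$. For $a\in\{x,y,z\}$, $r\in\{-1,1\}$, $P^a_r$ is the orthogonal projector onto the eigenspace of $\sigma_a$ for the eigenvalue $r$; $P^{\mathbf a}_{\mathbf r}=P^{a_1}_{r_1}\otimes\cdots\otimes P^{a_n}_{r_n}$. Data: $R^{\mathbf a,i}$, $\mathbf a\in\mathcal E^n$, $1\le i\le m$, are independent random variables with values in $\mathcal R^n$ such that $\mathbb P(R^{\mathbf a,i}=\mathbf r)=\mathrm{Tr}(\rho\cdot P^{\mathbf a}_{\mathbf r})$ for all $\mathbf r\in\mathcal R^n$. Put $\hat p_{(\mathbf r,\mathbf a)}=\frac1m\sum_{i=1}^m\delta_{R^{\mathbf a,i},\mathbf r}$ ($\delta$ the Kronecker symbol). Let $P_{(\mathbf r,\mathbf a),\mathbf b}=\prod_{j\notin E_{\mathbf b}}r_j\,\mathbf I(a_j=b_j)$ ($\mathbf I$ the indicator,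 empty products equal $1$). The linear estimator is $$\hat\rho_{\mathbf b}=\frac1{3^{d(\mathbf b)}2^n}\sum_{(\mathbf r,\mathbf a)\in\mathcal R^n\times\mathcal E^n}\hat p_{(\mathbf r,\mathbf a)}P_{(\mathbf r,\mathbf a),\mathbf b},\qquad \hat\rho=\sum_{\mathbf b\in\mathcal M^n}\hat\rho_{\mathbf b}\sigma_{\mathbf b}.$$ Norms: $\|A\|_F^2=\mathrm{Tr}(A^\dagger A)$ is the squared Frobenius norm; $\|A\|=\sup_{|v|_2=1}|Av|_2$ (over complex vectors $v$, with $|\cdot|_2$ the Euclidean norm) is the operator norm. $\hat\rho_\nu$ denotes any minimizer of the stated criterion. *)

theory Defs
  imports
    "HOL-Probability.Probability"
    "Jordan_Normal_Form.Char_Poly"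
    "Jordan_Normal_Form.DL_Rank"
    "Jordan_Normal_Form.Schur_Decomposition"
begin

unbundle no vec_syntax
hide_const (open) Finite_Cartesian_Product.mat Finite_Cartesian_Product.vec

section \<open>Complex matrices\<close>

definition mtrace :: "complex mat \<Rightarrow> complex" where
  "mtrace A = (\<Sum>i<dim_row A. A $$ (i, i))"

definition hermitian :: "complex mat \<Rightarrow> bool" where
  "hermitian A \<longleftrightarrow> mat_adjoint A = A"

definition density_matrix :: "nat \<Rightarrow> complex mat \<Rightarrow> bool" where
  "density_matrix N \<rho> \<longleftrightarrow> \<rho> \<in> carrier_mat N N \<and> hermitian \<rho> \<and>
     (\<forall>v \<in> carrier_vec N. 0 \<le> Re ((\<rho> *\<^sub>v v) \<bullet>c v)) \<and> mtrace \<rho> = 1"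

definition cvec_norm :: "complex vec \<Rightarrow> real" where
  "cvec_norm v = sqrt (\<Sum>i<dim_vec v. (cmod (v $ i))\<^sup>2)"

definition op_norm :: "complex mat \<Rightarrow> real" where
  "op_norm A = (SUP v \<in> {v \<in> carrier_vec (dim_col A). cvec_norm v = 1}. cvec_norm (A *\<^sub>v v))"

definition frob_norm_sq :: "complex mat \<Rightarrow> real" where
  "frob_norm_sq A = Re (mtrace (mat_adjoint A * A))"

definition kron :: "complex mat \<Rightarrow> complex mat \<Rightarrow> complex mat" (infixr \<open>\<otimes>\<^sub>K\<close> 70) where
  "A \<otimes>\<^sub>K B = mat (dim_row A * dim_row B) (dim_col A * dim_col B)
     (\<lambda>(i, j). A $$ (i div dim_row B, j div dim_col B) * B $$ (i mod dim_row B, j mod dim_col B))"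

definition kron_list :: "complex mat list \<Rightarrow> complex mat" where
  "kron_list As = foldr (\<otimes>\<^sub>K) As (1\<^sub>m 1)"

definition eigenspace :: "complex mat \<Rightarrow> complex \<Rightarrow> complex vec set" where
  "eigenspace A k = {v \<in> carrier_vec (dim_row A). A *\<^sub>v v = k \<cdot>\<^sub>v v}"

definition is_orth_projector :: "nat \<Rightarrow> complex vec set \<Rightarrow> complex mat \<Rightarrow> bool" where
  "is_orth_projector N V P \<longleftrightarrow> P \<in> carrier_mat N N \<and> hermitian P \<and> P * P = P \<and>
     (\<lambda>v. P *\<^sub>v v) ` carrier_vec N = V"

definition orth_projector :: "nat \<Rightarrow> complex vec set \<Rightarrow> complex mat" where
  "orth_projector N V = (THE P. is_orth_projector N V P)"

section \<open>Pauli measurements\<close>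

datatype pauli = PI | PX | PY | PZ

fun pauli_mat :: "pauli \<Rightarrow> complex mat" where
  "pauli_mat PI = 1\<^sub>m 2"
| "pauli_mat PX = mat_of_rows_list 2 [[0, 1], [1, 0]]"
| "pauli_mat PY = mat_of_rows_list 2 [[0, -\<i>], [\<i>, 0]]"
| "pauli_mat PZ = mat_of_rows_list 2 [[1, 0], [0, -1]]"

definition pauli_labels :: "nat \<Rightarrow> pauli list set" where
  "pauli_labels n = {b. length b = n}"

definition settings :: "nat \<Rightarrow> pauli list set" where
  "settings n = {a. length a = n \<and> set a \<subseteq> {PX, PY, PZ}}"

definition outcomes :: "nat \<Rightarrow> int list set" where
  "outcomes n = {r. length r = n \<and> set r \<subseteq> {-1, 1}}"

definition pauli_tensor :: "pauli list \<Rightarrow> complex mat" where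
  "pauli_tensor b = kron_list (map pauli_mat b)"

definition pauli_projector :: "pauli \<Rightarrow> int \<Rightarrow> complex mat" where
  "pauli_projector a r = orth_projector 2 (eigenspace (pauli_mat a) (of_int r))"

definition outcome_projector :: "pauli list \<Rightarrow> int list \<Rightarrow> complex mat" where
  "outcome_projector a r = kron_list (map2 pauli_projector a r)"

section \<open>The linear estimator\<close>

text \<open>Here \<open>D a i\<close> is the outcome observed in the \<open>i\<close>-th repetition (\<open>i = 1..m\<close>) under
  setting \<open>a\<close>.\<close>

definition emp_freq ::
  "nat \<Rightarrow> (pauli list \<Rightarrow> nat \<Rightarrow> int list) \<Rightarrow> int list \<Rightarrow> pauli list \<Rightarrow> real" where
  "emp_freq m D r a = (\<Sum>i = 1..m. of_bool (D a i = r)) / real m"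

definition id_positions :: "pauli list \<Rightarrow> nat set" where
  "id_positions b = {j. j < length b \<and> b ! j = PI}"

definition design_coeff :: "int list \<Rightarrow> pauli list \<Rightarrow> pauli list \<Rightarrow> real" where
  "design_coeff r a b =
     (\<Prod>j \<in> {..<length b} - id_positions b. of_int (r ! j) * of_bool (a ! j = b ! j))"

definition lin_est_coeff ::
  "nat \<Rightarrow> nat \<Rightarrow> (pauli list \<Rightarrow> nat \<Rightarrow> int list) \<Rightarrow> pauli list \<Rightarrow> real" where
  "lin_est_coeff n m D b = 1 / (3 ^ card (id_positions b) * 2 ^ n) *
     (\<Sum>(r, a) \<in> outcomes n \<times> settings n. emp_freq m D r a * design_coeff r a b)"

text \<open>The type of matrices has no additive unit, so the sum over labels is written entrywise.\<close>

definition lin_est :: "nat \<Rightarrow> nat \<Rightarrow> (pauli list \<Rightarrow> nat \<Rightarrow> int list) \<Rightarrow> complex mat" where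
  "lin_est n m D = mat (2 ^ n) (2 ^ n) (\<lambda>(i, j).
     \<Sum>b \<in> pauli_labels n. complex_of_real (lin_est_coeff n m D b) * pauli_tensor b $$ (i, j))"

text \<open>Independent Pauli measurement outcomes, \<open>m\<close> for each setting.  Measurability into
  \<open>count_space (outcomes n)\<close>, which is part of \<open>indep_vars\<close>, forces the values to lie in
  \<open>outcomes n\<close>.\<close>

definition pauli_data ::
  "'w measure \<Rightarrow> nat \<Rightarrow> nat \<Rightarrow> complex mat \<Rightarrow> (pauli list \<Rightarrow> nat \<Rightarrow> 'w \<Rightarrow> int list) \<Rightarrow> bool" where
  "pauli_data M n m \<rho> R \<longleftrightarrow>
     prob_space.indep_vars M (\<lambda>_. count_space (outcomes n)) (\<lambda>(a, i). R a i)
       (settings n \<times> {1..m}) \<and>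
     (\<forall>a \<in> settings n. \<forall>i \<in> {1..m}. \<forall>r \<in> outcomes n.
        complex_of_real (measure M {\<omega> \<in> space M. R a i \<omega> = r}) = mtrace (\<rho> * outcome_projector a r))"

section \<open>The rank-penalized estimator\<close>

definition rank_criterion :: "nat \<Rightarrow> real \<Rightarrow> complex mat \<Rightarrow> complex mat \<Rightarrow> real" where
  "rank_criterion N \<nu> A S = frob_norm_sq (S - A) + \<nu> * real (vec_space.rank N S)"

definition rank_penalized :: "nat \<Rightarrow> real \<Rightarrow> complex mat \<Rightarrow> complex mat \<Rightarrow> bool" where
  "rank_penalized N \<nu> A S \<longleftrightarrow>
     is_arg_min (rank_criterion N \<nu> A) (\<lambda>S. S \<in> carrier_mat N N \<and> hermitian S) S"

definition c_factor :: "real \<Rightarrow> real" where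
  "c_factor \<theta> = 1 + 2 / \<theta>"

text \<open>\<open>lam 1 \<ge> \<dots> \<ge> lam N\<close> are the eigenvalues of \<open>A\<close>, repeated according to algebraic
  multiplicity.\<close>

definition ordered_eigenvalues :: "nat \<Rightarrow> complex mat \<Rightarrow> (nat \<Rightarrow> real) \<Rightarrow> bool" where
  "ordered_eigenvalues N A lam \<longleftrightarrow>
     char_poly A = (\<Prod>j = 1..N. [:- complex_of_real (lam j), 1:]) \<and> antimono_on {1..N} lam"

section \<open>The Pauli projectors are well defined\<close>

lemma hermitian_index:
  assumes "A \<in> carrier_mat N N"
  shows "hermitian A \<longleftrightarrow> (\<forall>i<N. \<forall>j<N. A $$ (i, j) = cnj (A $$ (j, i)))"
proof -
  have c: "mat_adjoint A \<in> carrier_mat N N"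
    using assms by (simp add: mat_adjoint_def mat_of_rows_def)
  have e: "mat_adjoint A $$ (i, j) = cnj (A $$ (j, i))" if "i < N" "j < N" for i j
    using assms that by (simp add: mat_adjoint_def mat_of_rows_def)
  show ?thesis
  proof
    assume "hermitian A"
    then show "\<forall>i<N. \<forall>j<N. A $$ (i, j) = cnj (A $$ (j, i))"
      using e unfolding hermitian_def by metis
  next
    assume h: "\<forall>i<N. \<forall>j<N. A $$ (i, j) = cnj (A $$ (j, i))"
    show "hermitian A"
      unfolding hermitian_def
    proof (rule eq_matI)
      fix i j assume "i < dim_row A" "j < dim_col A"
      then have "i < N" "j < N" using assms by auto
      then show "mat_adjoint A $$ (i, j) = A $$ (i, j)"
        using e h by metis
    qed (use assms c in auto)
  qed
qed

lemma hermitian_mult_swap: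
  assumes P: "P \<in> carrier_mat N N" "hermitian P" and Q: "Q \<in> carrier_mat N N" "hermitian Q"
    and PQ: "P * Q = Q"
  shows "Q * P = Q"
proof (rule eq_matI)
  fix i j assume "i < dim_row Q" "j < dim_col Q"
  then have ij: "i < N" "j < N" using Q by auto
  have hP: "P $$ (i, j) = cnj (P $$ (j, i))" if "i < N" "j < N" for i j
    using that P hermitian_index by blast
  have hQ: "Q $$ (i, j) = cnj (Q $$ (j, i))" if "i < N" "j < N" for i j
    using that Q hermitian_index by blast
  have "(Q * P) $$ (i, j) = (\<Sum>k = 0..<N. Q $$ (i, k) * P $$ (k, j))"
    using ij P(1) Q(1) by (simp add: scalar_prod_def)
  also have "\<dots> = (\<Sum>k = 0..<N. cnj (P $$ (j, k) * Q $$ (k, i)))"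
  proof (rule sum.cong)
    fix k assume "k \<in> {0..<N}"
    then show "Q $$ (i, k) * P $$ (k, j) = cnj (P $$ (j, k) * Q $$ (k, i))"
      using hP[of k j] hQ[of i k] ij by (simp only: atLeastLessThan_iff complex_cnj_mult mult.commute)
  qed simp
  also have "\<dots> = cnj ((P * Q) $$ (j, i))"
    using ij P(1) Q(1) by (simp add: scalar_prod_def)
  also have "\<dots> = Q $$ (i, j)"
    using hQ[OF ij] PQ by simp
  finally show "(Q * P) $$ (i, j) = Q $$ (i, j)" .
qed (use P Q in auto)

lemma is_orth_projector_unique:
  assumes "is_orth_projector N V P" "is_orth_projector N V Q"
  shows "P = Q"
proof -
  have fix_range: "B * A = A" if "is_orth_projector N V A" "is_orth_projector N V B" for A B
  proof (rule eq_matI)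
    have c: "A \<in> carrier_mat N N" "B \<in> carrier_mat N N" and BB: "B * B = B"
      and rg: "(\<lambda>v. B *\<^sub>v v) ` carrier_vec N = (\<lambda>v. A *\<^sub>v v) ` carrier_vec N"
      using that by (auto simp: is_orth_projector_def)
    fix i j assume "i < dim_row A" "j < dim_col A"
    then have ij: "i < N" "j < N" using c by auto
    have "A *\<^sub>v unit_vec N j \<in> (\<lambda>v. B *\<^sub>v v) ` carrier_vec N"
      unfolding rg by (rule imageI) simp
    then obtain w where w: "w \<in> carrier_vec N" "A *\<^sub>v unit_vec N j = B *\<^sub>v w" by blast
    have col: "col A j = A *\<^sub>v unit_vec N j"
      by (rule eq_vecI) (use c(1) ij(2) in auto)
    have "B *\<^sub>v (A *\<^sub>v unit_vec N j) = B * B *\<^sub>v w"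
      using c w by (metis assoc_mult_mat_vec)
    then have "B *\<^sub>v (A *\<^sub>v unit_vec N j) = A *\<^sub>v unit_vec N j"
      using w(2) BB by simp
    then have "B *\<^sub>v col A j = col A j"
      unfolding col by simp
    then have "(B *\<^sub>v col A j) $ i = col A j $ i" by simp
    then show "(B * A) $$ (i, j) = A $$ (i, j)"
      using ij c by simp
  qed (use that in \<open>auto simp: is_orth_projector_def\<close>)
  have "Q * P = P"
    by (rule fix_range[OF assms])
  moreover have "Q * P = Q"
    using hermitian_mult_swap[of P N Q] fix_range[OF assms(2,1)] assms
    unfolding is_orth_projector_def by blast
  ultimately show ?thesis by simp
qed

lemma pauli_mat_carrier: "pauli_mat a \<in> carrier_mat 2 2"
  by (cases a) (auto simp: mat_of_rows_list_def)

lemma pauli_mat_entries: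
  "pauli_mat PX $$ (0, 0) = 0" "pauli_mat PX $$ (0, Suc 0) = 1"
  "pauli_mat PX $$ (Suc 0, 0) = 1" "pauli_mat PX $$ (Suc 0, Suc 0) = 0"
  "pauli_mat PY $$ (0, 0) = 0" "pauli_mat PY $$ (0, Suc 0) = -\<i>"
  "pauli_mat PY $$ (Suc 0, 0) = \<i>" "pauli_mat PY $$ (Suc 0, Suc 0) = 0"
  "pauli_mat PZ $$ (0, 0) = 1" "pauli_mat PZ $$ (0, Suc 0) = 0"
  "pauli_mat PZ $$ (Suc 0, 0) = 0" "pauli_mat PZ $$ (Suc 0, Suc 0) = -1"
  by (simp_all add: mat_of_rows_list_def)

lemma pauli_projector_eq:
  assumes a: "a \<in> {PX, PY, PZ}" and r: "r \<in> {-1, 1}"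
  shows "pauli_projector a r = (1 / 2) \<cdot>\<^sub>m (1\<^sub>m 2 + of_int r \<cdot>\<^sub>m pauli_mat a)"
    (is "_ = ?P")
proof -
  have less2: "i < 2 \<longleftrightarrow> i = 0 \<or> i = Suc 0" for i :: nat by auto
  have ivl: "{0..<2::nat} = {0, Suc 0}" by auto
  have cS: "pauli_mat a \<in> carrier_mat 2 2" by (rule pauli_mat_carrier)
  then have dS: "dim_row (pauli_mat a) = 2" "dim_col (pauli_mat a) = 2" by auto
  have cP: "?P \<in> carrier_mat 2 2" using cS by simp
  have eP: "?P $$ (i, j) = (of_bool (i = j) + of_int r * pauli_mat a $$ (i, j)) / 2"
    if "i < 2" "j < 2" for i j
    using that dS by simp
  define P where "P = ?P"
  note PD = eP[folded P_def] and cP' = cP[folded P_def]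
  have dP: "dim_row P = 2" "dim_col P = 2" using cP' by auto
  have her: "hermitian P"
    unfolding hermitian_index[OF cP']
    using a r by (auto simp: less2 PD pauli_mat_entries simp del: pauli_mat.simps)
  have idem: "P * P = P"
    by (rule eq_matI)
      (use a r in \<open>auto simp: dP less2 PD pauli_mat_entries scalar_prod_def ivl simp del: pauli_mat.simps\<close>)
  have sP: "pauli_mat a * P = of_int r \<cdot>\<^sub>m P"
    by (rule eq_matI)
      (use a r in \<open>auto simp: dP dS less2 PD pauli_mat_entries scalar_prod_def ivl simp del: pauli_mat.simps\<close>)
  have "P *\<^sub>v v \<in> eigenspace (pauli_mat a) (of_int r)" if v: "v \<in> carrier_vec 2" for v
  proof -
    have "pauli_mat a *\<^sub>v (P *\<^sub>v v) = (of_int r \<cdot>\<^sub>m P) *\<^sub>v v"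
      using v cS cP' sP by (metis assoc_mult_mat_vec)
    also have "\<dots> = of_int r \<cdot>\<^sub>v (P *\<^sub>v v)"
      by (rule eq_vecI) (use v dP in \<open>auto simp: scalar_prod_def sum_distrib_left mult.assoc\<close>)
    finally show ?thesis using cS cP' v by (simp add: eigenspace_def)
  qed
  moreover have "v \<in> (\<lambda>v. P *\<^sub>v v) ` carrier_vec 2"
    if "v \<in> eigenspace (pauli_mat a) (of_int r)" for v
  proof (rule image_eqI)
    show v: "v \<in> carrier_vec 2" using that dS by (simp add: eigenspace_def)
    have ev: "pauli_mat a *\<^sub>v v = of_int r \<cdot>\<^sub>v v" using that by (simp add: eigenspace_def)
    have rr: "of_int r * of_int r = (1 :: complex)" using r by auto
    show "v = P *\<^sub>v v"
    proof (rule eq_vecI)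
      fix i assume "i < dim_vec (P *\<^sub>v v)"
      then have i: "i < 2" using dP by simp
      have "(pauli_mat a *\<^sub>v v) $ i = of_int r * v $ i" using i v by (simp add: ev)
      then have s: "(\<Sum>j = 0..<2. pauli_mat a $$ (i, j) * v $ j) = of_int r * v $ i"
        using i v dS by (simp add: scalar_prod_def)
      have "(P *\<^sub>v v) $ i = (\<Sum>j = 0..<2. P $$ (i, j) * v $ j)"
        using i v dP by (simp add: scalar_prod_def)
      also have "\<dots> = (\<Sum>j = 0..<2. of_bool (i = j) * v $ j / 2
                         + of_int r / 2 * (pauli_mat a $$ (i, j) * v $ j))"
        by (rule sum.cong) (use i in \<open>simp_all add: PD field_simps\<close>)
      also have "\<dots> = (\<Sum>j = 0..<2. of_bool (i = j) * v $ j / 2) + of_int r / 2 * (of_int r * v $ i)"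
        by (simp only: sum.distrib sum_distrib_left[symmetric] s)
      also have "(\<Sum>j = 0..<2. of_bool (i = j) * v $ j / 2) = v $ i / 2"
        using i by (auto simp: ivl less2)
      also have "v $ i / 2 + of_int r / 2 * (of_int r * v $ i) = v $ i"
        using rr by (simp add: mult.assoc[symmetric])
      finally show "v $ i = (P *\<^sub>v v) $ i" by simp
    qed (use v dP in auto)
  qed
  ultimately have "is_orth_projector 2 (eigenspace (pauli_mat a) (of_int r)) P"
    using cP' her idem unfolding is_orth_projector_def by blast
  then show ?thesis
    unfolding pauli_projector_def orth_projector_def P_def[symmetric]
    by (intro the_equality is_orth_projector_unique)
qed

end

theory Submission
  imports Defs
begin


text \<open>
  Write \<open>\<Delta> = A - \<rho>\<close> for the error of the estimator \<open>A\<close>, let \<open>S\<close> minimize the penalized criterion, and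
  let \<open>T\<close> be any Hermitian competitor. The argument is deterministic: it uses only
  \<open>(1 + \<theta>) \<parallel>\<Delta>\<parallel>\<^sup>2 \<le> \<nu>\<close> and is carried out in \<open>rank_penalized_oracle_inequality\<close>.

  Expanding the squares around \<open>\<rho>\<close> turns minimality of \<open>S\<close> into
  \<open>\<parallel>S - \<rho>\<parallel>\<^sub>F\<^sup>2 \<le> \<parallel>T - \<rho>\<parallel>\<^sub>F\<^sup>2 + 2 \<langle>\<Delta>, S - T\<rangle> + \<nu> (rank T - rank S)\<close>.
  The inner product is controlled by the duality between operator and trace norm in the form
  \<open>\<langle>\<Delta>, B\<rangle> \<le> \<parallel>\<Delta>\<parallel> \<surd>(rank B) \<parallel>B\<parallel>\<^sub>F\<close> (\<open>frob_inner_le_op_norm_rank\<close>), applied to \<open>B = S - T\<close>, whose rank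
  is at most the sum of the two ranks. Two weighted arithmetic-geometric mean inequalities, with
  weights \<open>1 + \<theta>/2\<close> and \<open>\<theta>/2\<close> adding up to \<open>1 + \<theta>\<close>, split the product so that the operator norm is
  absorbed into \<open>\<nu>\<close>; then the rank of \<open>S\<close> cancels against the penalty
  (\<open>penalized_quadratic_bound\<close>).

  It remains to choose \<open>T\<close>. For each \<open>k\<close>, cutting the spectral decomposition of \<open>\<rho>\<close> after \<open>k\<close> terms
  gives a Hermitian matrix of rank at most \<open>k\<close> at squared distance \<open>\<Sum>j>k. \<lambda>\<^sub>j\<^sup>2\<close>
  (\<open>hermitian_low_rank_approximation\<close>).

  Both the duality and the truncation are computations with sums \<open>\<Sum>l. u\<^sub>l w\<^sub>l\<^sup>*\<close> of rank-one matrices in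
  which the \<open>u\<^sub>l\<close> are orthonormal. Every matrix of rank \<open>r\<close> is such a sum of \<open>r\<close> terms
  (\<open>rank_factorization\<close>), obtained from an orthonormal basis of its column space.
\<close>

section \<open>Adjoints and the Frobenius inner product\<close>

lemma mat_adjoint_dim [simp]:
  fixes A :: "complex mat"
  shows "dim_row (mat_adjoint A) = dim_col A" "dim_col (mat_adjoint A) = dim_row A"
  by (simp_all add: mat_adjoint_def)

lemma mat_adjoint_index [simp]:
  fixes A :: "complex mat"
  assumes "i < dim_col A" "j < dim_row A"
  shows "mat_adjoint A $$ (i, j) = cnj (A $$ (j, i))"
  using assms by (simp add: mat_adjoint_def mat_of_rows_def)

lemma mat_adjoint_carrier [simp]:
  fixes A :: "complex mat"
  assumes "A \<in> carrier_mat nr nc"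
  shows "mat_adjoint A \<in> carrier_mat nc nr"
  by (rule carrier_matI) (use assms in auto)

lemma mat_adjoint_mat_adjoint [simp]:
  fixes A :: "complex mat"
  shows "mat_adjoint (mat_adjoint A) = A"
  by (rule eq_matI) auto

lemma mat_adjoint_mult:
  fixes A B :: "complex mat"
  assumes "A \<in> carrier_mat nr nk" "B \<in> carrier_mat nk nc"
  shows "mat_adjoint (A * B) = mat_adjoint B * mat_adjoint A"
  by (rule eq_matI) (use assms in \<open>auto simp: scalar_prod_def mult.commute\<close>)

lemma mat_adjoint_four_block:
  fixes A B C D :: "complex mat"
  assumes "A \<in> carrier_mat nr1 nc1" "B \<in> carrier_mat nr1 nc2"
    "C \<in> carrier_mat nr2 nc1" "D \<in> carrier_mat nr2 nc2"
  shows "mat_adjoint (four_block_mat A B C D) =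
    four_block_mat (mat_adjoint A) (mat_adjoint C) (mat_adjoint B) (mat_adjoint D)"
  by (rule eq_matI) (use assms in auto)

definition frob_inner :: "complex mat \<Rightarrow> complex mat \<Rightarrow> real" where
  "frob_inner A B = Re (\<Sum>(i, j) \<in> {..<dim_row A} \<times> {..<dim_col A}. cnj (A $$ (i, j)) * B $$ (i, j))"

lemma frob_norm_sq_eq_sum:
  "frob_norm_sq A = (\<Sum>(i, j) \<in> {..<dim_row A} \<times> {..<dim_col A}. (cmod (A $$ (i, j)))\<^sup>2)"
proof -
  have "frob_norm_sq A = Re (\<Sum>j<dim_col A. \<Sum>i<dim_row A. cnj (A $$ (i, j)) * A $$ (i, j))"
    unfolding frob_norm_sq_def mtrace_def
    by (simp add: scalar_prod_def atLeast0LessThan)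
  also have "(\<Sum>j<dim_col A. \<Sum>i<dim_row A. cnj (A $$ (i, j)) * A $$ (i, j)) =
    (\<Sum>i<dim_row A. \<Sum>j<dim_col A. of_real ((cmod (A $$ (i, j)))\<^sup>2))"
    by (subst sum.swap) (simp add: complex_norm_square mult.commute del: of_real_power)
  finally show ?thesis
    by (simp add: sum.cartesian_product del: of_real_power)
qed

lemma frob_norm_sq_nonneg [simp]: "0 \<le> frob_norm_sq A"
  by (auto simp: frob_norm_sq_eq_sum intro!: sum_nonneg)

lemma frob_inner_minus_right:
  assumes "A \<in> carrier_mat nr nc" "B \<in> carrier_mat nr nc" "C \<in> carrier_mat nr nc"
  shows "frob_inner A (B - C) = frob_inner A B - frob_inner A C"
proof -
  have "(\<Sum>(i, j) \<in> {..<nr} \<times> {..<nc}. cnj (A $$ (i, j)) * (B - C) $$ (i, j)) =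
      (\<Sum>(i, j) \<in> {..<nr} \<times> {..<nc}. cnj (A $$ (i, j)) * B $$ (i, j) - cnj (A $$ (i, j)) * C $$ (i, j))"
    using assms by (intro sum.cong) (auto simp: right_diff_distrib)
  then show ?thesis
    using assms by (simp add: frob_inner_def case_prod_beta sum_subtractf)
qed

text \<open>The law of cosines. It is used to expand the criterion around \<open>\<rho>\<close> instead of the data.\<close>

lemma frob_norm_sq_minus:
  assumes "A \<in> carrier_mat nr nc" "B \<in> carrier_mat nr nc"
  shows "frob_norm_sq (A - B) = frob_norm_sq A - 2 * frob_inner B A + frob_norm_sq B"
proof -
  have "(cmod (a - b))\<^sup>2 = (cmod a)\<^sup>2 - 2 * Re (cnj b * a) + (cmod b)\<^sup>2" for a b
    by (simp only: cmod_power2) (simp add: power2_eq_square algebra_simps)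
  then have "(\<Sum>(i, j) \<in> {..<nr} \<times> {..<nc}. (cmod ((A - B) $$ (i, j)))\<^sup>2) =
      (\<Sum>(i, j) \<in> {..<nr} \<times> {..<nc}. (cmod (A $$ (i, j)))\<^sup>2
         - 2 * Re (cnj (B $$ (i, j)) * A $$ (i, j)) + (cmod (B $$ (i, j)))\<^sup>2)"
    using assms by (intro sum.cong) auto
  then show ?thesis
    using assms unfolding frob_norm_sq_eq_sum frob_inner_def Re_sum
    by (simp add: case_prod_beta sum.distrib sum_subtractf sum_distrib_left)
qed

lemma sqrt_frob_norm_sq_triangle:
  assumes "A \<in> carrier_mat nr nc" "B \<in> carrier_mat nr nc"
  shows "sqrt (frob_norm_sq (A - B)) \<le> sqrt (frob_norm_sq A) + sqrt (frob_norm_sq B)"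
proof -
  let ?I = "{..<nr} \<times> {..<nc}"
  have L2: "sqrt (frob_norm_sq C) = L2_set (\<lambda>ij. cmod (C $$ ij)) ?I" if "C \<in> carrier_mat nr nc" for C
    using that by (simp add: frob_norm_sq_eq_sum L2_set_def case_prod_beta)
  have "L2_set (\<lambda>ij. cmod ((A - B) $$ ij)) ?I \<le>
      L2_set (\<lambda>ij. cmod (A $$ ij) + cmod (B $$ ij)) ?I"
    by (rule L2_set_mono) (use assms in \<open>auto intro: norm_triangle_ineq4\<close>)
  also have "\<dots> \<le> L2_set (\<lambda>ij. cmod (A $$ ij)) ?I + L2_set (\<lambda>ij. cmod (B $$ ij)) ?I"
    by (rule L2_set_triangle_ineq)
  finally show ?thesis
    by (simp only: L2[OF assms(1)] L2[OF assms(2)] L2[OF minus_carrier_mat[OF assms(2)]])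
qed

section \<open>The operator norm\<close>

lemma cvec_norm_eq_L2_set: "cvec_norm v = L2_set (\<lambda>i. cmod (v $ i)) {..<dim_vec v}"
  by (simp add: cvec_norm_def L2_set_def)

lemma cvec_norm_nonneg [simp]: "0 \<le> cvec_norm v"
  by (simp add: cvec_norm_eq_L2_set L2_set_nonneg)

lemma cvec_norm_smult: "cvec_norm (c \<cdot>\<^sub>v v) = cmod c * cvec_norm v"
proof -
  have "cvec_norm (c \<cdot>\<^sub>v v) = L2_set (\<lambda>i. cmod c * cmod (v $ i)) {..<dim_vec v}"
    unfolding cvec_norm_eq_L2_set by (rule L2_set_cong) (simp_all add: norm_mult)
  then show ?thesis
    by (simp add: cvec_norm_eq_L2_set L2_set_right_distrib)
qed

lemma cscalar_prod_self: "v \<bullet>c v = complex_of_real ((cvec_norm v)\<^sup>2)"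
  by (simp add: cvec_norm_def scalar_prod_def atLeast0LessThan sum_nonneg
      complex_norm_square[symmetric] flip: of_real_power)

lemma cvec_norm_eq_0_iff:
  assumes "v \<in> carrier_vec n"
  shows "cvec_norm v = 0 \<longleftrightarrow> v = 0\<^sub>v n"
  using conjugate_square_eq_0_vec[OF assms] by (simp add: cscalar_prod_self)

lemma cmod_sum_mult_cnj_le:
  assumes "v \<in> carrier_vec n" "w \<in> carrier_vec n"
  shows "cmod (\<Sum>i<n. v $ i * cnj (w $ i)) \<le> cvec_norm v * cvec_norm w"
proof -
  have "cmod (\<Sum>i<n. v $ i * cnj (w $ i)) \<le> (\<Sum>i<n. \<bar>cmod (v $ i)\<bar> * \<bar>cmod (w $ i)\<bar>)"
    by (rule order.trans[OF norm_sum]) (simp add: norm_mult)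
  also have "\<dots> \<le> cvec_norm v * cvec_norm w"
    using assms L2_set_mult_ineq[of "\<lambda>i. cmod (v $ i)" "\<lambda>i. cmod (w $ i)" "{..<n}"]
    by (simp add: cvec_norm_eq_L2_set)
  finally show ?thesis .
qed

text \<open>The supremum in the definition of \<open>op_norm\<close> only has content once it is known to be over a
  bounded set; Cauchy--Schwarz on each row of \<open>A\<close> gives a bound.\<close>

lemma bdd_above_op_norm:
  "bdd_above ((\<lambda>v. cvec_norm (A *\<^sub>v v)) ` {v \<in> carrier_vec (dim_col A). cvec_norm v = 1})"
proof (rule bdd_aboveI2)
  fix v assume v: "v \<in> {v \<in> carrier_vec (dim_col A). cvec_norm v = 1}"
  have "cmod ((A *\<^sub>v v) $ i) \<le> cvec_norm (conjugate (row A i))" if "i < dim_row A" for i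
  proof -
    have "(A *\<^sub>v v) $ i = (\<Sum>j<dim_col A. v $ j * cnj (conjugate (row A i) $ j))"
      using that v by (auto simp: scalar_prod_def atLeast0LessThan mult.commute intro!: sum.cong)
    then show ?thesis
      using cmod_sum_mult_cnj_le[of v "dim_col A" "conjugate (row A i)"] v that by simp
  qed
  then show "cvec_norm (A *\<^sub>v v) \<le>
      L2_set (\<lambda>i. cvec_norm (conjugate (row A i))) {..<dim_row A}"
    by (auto simp: cvec_norm_eq_L2_set intro!: L2_set_mono)
qed

lemma cvec_norm_mult_mat_vec_le:
  assumes A: "A \<in> carrier_mat nr nc" and v: "v \<in> carrier_vec nc"
  shows "cvec_norm (A *\<^sub>v v) \<le> op_norm A * cvec_norm v"
proof (cases "cvec_norm v = 0")
  case True
  then have "A *\<^sub>v v = 0\<^sub>v nr"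
    using A v by (auto simp: cvec_norm_eq_0_iff)
  then have "cvec_norm (A *\<^sub>v v) = 0"
    by (simp add: cvec_norm_eq_0_iff[of _ nr])
  then show ?thesis
    using True by simp
next
  case False
  define u where "u = complex_of_real (1 / cvec_norm v) \<cdot>\<^sub>v v"
  have u: "u \<in> carrier_vec nc" "cvec_norm u = 1"
    using v False by (simp_all add: u_def cvec_norm_smult norm_divide)
  have v_eq: "v = complex_of_real (cvec_norm v) \<cdot>\<^sub>v u"
    using False by (auto simp: u_def smult_smult_assoc)
  have "A *\<^sub>v v = complex_of_real (cvec_norm v) \<cdot>\<^sub>v (A *\<^sub>v u)"
    using mult_mat_vec[OF A u(1), of "complex_of_real (cvec_norm v)"] v_eq by metis
  then have "cvec_norm (A *\<^sub>v v) = cvec_norm v * cvec_norm (A *\<^sub>v u)"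
    by (simp add: cvec_norm_smult)
  moreover have "cvec_norm (A *\<^sub>v u) \<le> op_norm A"
    unfolding op_norm_def by (rule cSUP_upper[OF _ bdd_above_op_norm]) (use A u in auto)
  ultimately show ?thesis
    by (simp add: mult.commute[of _ "cvec_norm v"] mult_left_mono)
qed


section \<open>Sums of rank-one matrices\<close>

text \<open>The matrix \<open>\<Sum>l<r. u\<^sub>l w\<^sub>l\<^sup>*\<close>.\<close>

definition outer_sum :: "nat \<Rightarrow> nat \<Rightarrow> (nat \<Rightarrow> complex vec) \<Rightarrow> (nat \<Rightarrow> complex vec) \<Rightarrow> complex mat" where
  "outer_sum N r u w = mat N N (\<lambda>(i, j). \<Sum>l<r. u l $ i * cnj (w l $ j))"

definition orthonormal_family :: "nat \<Rightarrow> nat \<Rightarrow> (nat \<Rightarrow> complex vec) \<Rightarrow> bool" where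
  "orthonormal_family N r u \<longleftrightarrow> (\<forall>l<r. u l \<in> carrier_vec N) \<and>
     (\<forall>l<r. \<forall>m<r. (\<Sum>i<N. u l $ i * cnj (u m $ i)) = of_bool (l = m))"

lemma outer_sum_carrier [simp]: "outer_sum N r u w \<in> carrier_mat N N"
  "dim_row (outer_sum N r u w) = N" "dim_col (outer_sum N r u w) = N"
  by (simp_all add: outer_sum_def)

lemma outer_sum_index [simp]:
  "i < N \<Longrightarrow> j < N \<Longrightarrow> outer_sum N r u w $$ (i, j) = (\<Sum>l<r. u l $ i * cnj (w l $ j))"
  by (simp add: outer_sum_def)

lemma cvec_norm_sq: "v \<in> carrier_vec N \<Longrightarrow> (cvec_norm v)\<^sup>2 = (\<Sum>i<N. (cmod (v $ i))\<^sup>2)"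
  by (auto simp: cvec_norm_def sum_nonneg)

lemma orthonormal_family_cvec_norm:
  assumes "orthonormal_family N r u" "l < r"
  shows "cvec_norm (u l) = 1"
proof -
  have u: "u l \<in> carrier_vec N" and "(\<Sum>i<N. u l $ i * cnj (u l $ i)) = 1"
    using assms by (auto simp: orthonormal_family_def)
  then have "complex_of_real ((cvec_norm (u l))\<^sup>2) = 1"
    by (simp add: cscalar_prod_self[symmetric] scalar_prod_def atLeast0LessThan del: of_real_power)
  then have "(cvec_norm (u l))\<^sup>2 = 1"
    by (metis of_real_eq_1_iff)
  then show ?thesis
    by (metis cvec_norm_nonneg power2_eq_1_iff not_one_le_zero neg_0_le_iff_le)
qed

lemma rank_outer_sum_le: "vec_space.rank N (outer_sum N r u w) \<le> r"
proof (induction r)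
  case 0
  have "outer_sum N 0 u w = 0\<^sub>m N N"
    by (rule eq_matI) auto
  then show ?case
    by (simp add: vec_space.rank_0I)
next
  case (Suc r)
  define T where "T = mat N N (\<lambda>(i, j). u r $ i * cnj (w r $ j))"
  have "outer_sum N (Suc r) u w = outer_sum N r u w + T"
    by (rule eq_matI) (auto simp: T_def)
  moreover have "vec_space.rank N T \<le> 1"
    by (rule vec_space.rank_le_1_product_entries[of _ N N "\<lambda>i. u r $ i" "\<lambda>j. cnj (w r $ j)"])
      (auto simp: T_def)
  moreover have "vec_space.rank N (outer_sum N r u w + T) \<le>
      vec_space.rank N (outer_sum N r u w) + vec_space.rank N T"
    by (rule vec_space.rank_subadditive[of _ N N]) (auto simp: T_def)
  ultimately show ?case
    using Suc by simp
qed

text \<open>A Parseval identity: by orthonormality of the \<open>u\<^sub>l\<close>, column \<open>j\<close> of the sum, which has coordinates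
  \<open>cnj (w\<^sub>l $ j)\<close> in the family \<open>u\<close>, contributes only the diagonal terms.\<close>

lemma frob_norm_sq_outer_sum:
  assumes u: "orthonormal_family N r u" and w: "\<And>l. l < r \<Longrightarrow> w l \<in> carrier_vec N"
  shows "frob_norm_sq (outer_sum N r u w) = (\<Sum>l<r. (cvec_norm (w l))\<^sup>2)"
proof -
  have orth: "(\<Sum>i<N. u l $ i * cnj (u m $ i)) = of_bool (l = m)" if "l < r" "m < r" for l m
    using u that by (simp add: orthonormal_family_def)
  have col: "(\<Sum>i<N. (cmod (\<Sum>l<r. u l $ i * cnj (w l $ j)))\<^sup>2) = (\<Sum>l<r. (cmod (w l $ j))\<^sup>2)" for j
  proof -
    have "complex_of_real (\<Sum>i<N. (cmod (\<Sum>l<r. u l $ i * cnj (w l $ j)))\<^sup>2) =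
        (\<Sum>i<N. (\<Sum>l<r. u l $ i * cnj (w l $ j)) * (\<Sum>m<r. cnj (u m $ i) * w m $ j))"
      by (simp add: complex_norm_square del: of_real_power)
    also have "\<dots> = (\<Sum>i<N. \<Sum>l<r. \<Sum>m<r. (cnj (w l $ j) * w m $ j) * (u l $ i * cnj (u m $ i)))"
      by (simp add: sum_product mult_ac)
    also have "\<dots> = (\<Sum>l<r. \<Sum>m<r. \<Sum>i<N. (cnj (w l $ j) * w m $ j) * (u l $ i * cnj (u m $ i)))"
      by (subst sum.swap) (intro sum.cong refl sum.swap)
    also have "\<dots> = (\<Sum>l<r. \<Sum>m<r. (cnj (w l $ j) * w m $ j) * of_bool (l = m))"
      by (intro sum.cong refl) (simp add: sum_distrib_left[symmetric] orth)
    also have "\<dots> = (\<Sum>l<r. cnj (w l $ j) * w l $ j)"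
      by (simp add: of_bool_def if_distrib sum.delta cong: if_cong)
    also have "\<dots> = complex_of_real (\<Sum>l<r. (cmod (w l $ j))\<^sup>2)"
      by (simp add: complex_norm_square mult.commute del: of_real_power)
    finally show ?thesis
      by (simp only: of_real_eq_iff)
  qed
  have "frob_norm_sq (outer_sum N r u w) =
      (\<Sum>j<N. \<Sum>i<N. (cmod (\<Sum>l<r. u l $ i * cnj (w l $ j)))\<^sup>2)"
    by (subst sum.swap) (auto simp: frob_norm_sq_eq_sum sum.cartesian_product intro!: sum.cong)
  also have "\<dots> = (\<Sum>l<r. \<Sum>j<N. (cmod (w l $ j))\<^sup>2)"
    by (subst sum.swap) (simp add: col)
  also have "\<dots> = (\<Sum>l<r. (cvec_norm (w l))\<^sup>2)"
    by (intro sum.cong refl cvec_norm_sq[symmetric]) (simp add: w)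
  finally show ?thesis .
qed

text \<open>Moving \<open>D\<close> onto the second factor, the inner product becomes \<open>\<Sum>l. \<langle>u\<^sub>l, D w\<^sub>l\<rangle>\<close>, and each term is
  at most \<open>\<parallel>D\<parallel> \<parallel>w\<^sub>l\<parallel>\<close>. The factor \<open>\<surd>r\<close> is the price of comparing the sum of the \<open>\<parallel>w\<^sub>l\<parallel>\<close> with their
  Euclidean norm, which is the Frobenius norm of the sum of the \<open>u\<^sub>l w\<^sub>l\<^sup>*\<close>.\<close>

lemma frob_inner_outer_sum_le:
  assumes D: "D \<in> carrier_mat N N" and u: "orthonormal_family N r u"
    and w: "\<And>l. l < r \<Longrightarrow> w l \<in> carrier_vec N"
  shows "frob_inner D (outer_sum N r u w) \<le>
    op_norm D * sqrt (real r) * sqrt (frob_norm_sq (outer_sum N r u w))"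
proof -
  have uc: "u l \<in> carrier_vec N" if "l < r" for l
    using u that by (simp add: orthonormal_family_def)
  have "frob_inner D (outer_sum N r u w) =
      Re (\<Sum>i<N. \<Sum>j<N. cnj (D $$ (i, j)) * (\<Sum>l<r. u l $ i * cnj (w l $ j)))"
    using D unfolding frob_inner_def sum.cartesian_product
    by (intro arg_cong[where f = Re] sum.cong) auto
  also have "(\<Sum>i<N. \<Sum>j<N. cnj (D $$ (i, j)) * (\<Sum>l<r. u l $ i * cnj (w l $ j))) =
      (\<Sum>i<N. \<Sum>j<N. \<Sum>l<r. u l $ i * cnj (D $$ (i, j) * w l $ j))"
    by (simp add: sum_distrib_left mult_ac)
  also have "\<dots> = (\<Sum>i<N. \<Sum>l<r. \<Sum>j<N. u l $ i * cnj (D $$ (i, j) * w l $ j))"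
    by (intro sum.cong refl sum.swap)
  also have "\<dots> = (\<Sum>l<r. \<Sum>i<N. \<Sum>j<N. u l $ i * cnj (D $$ (i, j) * w l $ j))"
    by (rule sum.swap)
  also have "\<dots> = (\<Sum>l<r. \<Sum>i<N. u l $ i * cnj ((D *\<^sub>v w l) $ i))"
  proof (intro sum.cong refl)
    fix l i assume "l \<in> {..<r}" "i \<in> {..<N}"
    then have "(D *\<^sub>v w l) $ i = (\<Sum>j<N. D $$ (i, j) * w l $ j)"
      using D w[of l] by (auto simp: scalar_prod_def atLeast0LessThan intro!: sum.cong)
    then show "(\<Sum>j<N. u l $ i * cnj (D $$ (i, j) * w l $ j)) = u l $ i * cnj ((D *\<^sub>v w l) $ i)"
      by (simp add: sum_distrib_left)
  qed
  also have "Re \<dots> \<le> cmod \<dots>"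
    by (rule complex_Re_le_cmod)
  also have "\<dots> \<le> (\<Sum>l<r. cmod (\<Sum>i<N. u l $ i * cnj ((D *\<^sub>v w l) $ i)))"
    by (rule norm_sum)
  also have "\<dots> \<le> (\<Sum>l<r. op_norm D * cvec_norm (w l))"
  proof (rule sum_mono)
    fix l assume "l \<in> {..<r}"
    then have l: "l < r" by simp
    have "cmod (\<Sum>i<N. u l $ i * cnj ((D *\<^sub>v w l) $ i)) \<le> cvec_norm (u l) * cvec_norm (D *\<^sub>v w l)"
      by (rule cmod_sum_mult_cnj_le) (use D uc w l in auto)
    also have "\<dots> \<le> op_norm D * cvec_norm (w l)"
      using cvec_norm_mult_mat_vec_le[OF D w[OF l]] orthonormal_family_cvec_norm[OF u l] by simp
    finally show "cmod (\<Sum>i<N. u l $ i * cnj ((D *\<^sub>v w l) $ i)) \<le> op_norm D * cvec_norm (w l)" .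
  qed
  also have "\<dots> = op_norm D * (\<Sum>l<r. \<bar>1\<bar> * \<bar>cvec_norm (w l)\<bar>)"
    by (simp add: sum_distrib_left)
  also have "\<dots> \<le> op_norm D * (L2_set (\<lambda>_. 1) {..<r} * L2_set (\<lambda>l. cvec_norm (w l)) {..<r})"
  proof (cases "r = 0")
    case False
    then have "0 \<le> op_norm D"
      using cvec_norm_mult_mat_vec_le[OF D uc[of 0]] orthonormal_family_cvec_norm[OF u, of 0]
        order.trans[OF cvec_norm_nonneg[of "D *\<^sub>v u 0"]] by simp
    then show ?thesis
      by (intro mult_left_mono L2_set_mult_ineq)
  qed simp
  also have "\<dots> = op_norm D * sqrt (real r) * sqrt (frob_norm_sq (outer_sum N r u w))"
    using frob_norm_sq_outer_sum[OF u w] by (simp add: L2_set_def)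
  finally show ?thesis .
qed

section \<open>Orthonormal bases\<close>

text \<open>Gram--Schmidt followed by normalization. The last conjunct records that the first basis vector
  keeps its direction, which lets an eigenvector be the first column of a unitary matrix.\<close>

lemma exists_orthonormal_basis:
  assumes vs: "set vs \<subseteq> carrier_vec N" "distinct vs"
    "\<not> module.lin_dep class_ring (module_vec TYPE(complex) N) (set vs)"
  shows "\<exists>u c. orthonormal_family N (length vs) u \<and>
     (\<forall>x \<in> LinearCombinations.module.span class_ring (module_vec TYPE(complex) N) (set vs).
        \<exists>a. \<forall>i<N. x $ i = (\<Sum>l<length vs. a l * u l $ i)) \<and>
     (vs \<noteq> [] \<longrightarrow> c \<noteq> 0 \<and> u 0 = c \<cdot>\<^sub>v hd vs)"
proof -
  interpret cof_vec_space N "TYPE(complex)" .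
  define us where "us = gram_schmidt N vs"
  define r where "r = length vs"
  have us: "span (set vs) = span (set us)" "corthogonal us" "set us \<subseteq> carrier_vec N"
    "length us = r" "distinct us"
    using gram_schmidt_result[OF vs us_def] by (simp_all add: r_def)
  have uc: "us ! l \<in> carrier_vec N" if "l < r" for l
    using us that nth_mem by blast
  have sp: "(\<Sum>i<N. us ! l $ i * cnj (us ! m $ i)) = us ! l \<bullet>c us ! m" if "l < r" "m < r" for l m
    using uc[OF that(1)] uc[OF that(2)] by (simp add: scalar_prod_def atLeast0LessThan)
  define d where "d l = complex_of_real (cvec_norm (us ! l))" for l
  have self: "us ! l \<bullet>c us ! l = d l * d l" for l
    by (simp add: cscalar_prod_self d_def power2_eq_square)
  have d0: "d l \<noteq> 0" if "l < r" for l
    using corthogonalD[OF us(2), of l l] that us(4) self[of l] by auto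
  have cd: "cnj (d l) = d l" for l by (simp add: d_def)
  define u where "u l = (1 / d l) \<cdot>\<^sub>v us ! l" for l
  have "orthonormal_family N r u"
    unfolding orthonormal_family_def
  proof (intro conjI allI impI)
    fix l m assume lm: "l < r" "m < r"
    have "(\<Sum>i<N. u l $ i * cnj (u m $ i)) = (\<Sum>i<N. us ! l $ i * cnj (us ! m $ i)) / (d l * d m)"
      unfolding sum_divide_distrib using uc[OF lm(1)] uc[OF lm(2)]
      by (intro sum.cong) (auto simp: u_def cd)
    also have "\<dots> = of_bool (l = m)"
      using lm d0 self sp corthogonalD[OF us(2), of l m] us(4) by auto
    finally show "(\<Sum>i<N. u l $ i * cnj (u m $ i)) = of_bool (l = m)" .
  qed (use uc in \<open>auto simp: u_def\<close>)
  moreover have "\<exists>a. \<forall>i<N. x $ i = (\<Sum>l<r. a l * u l $ i)" if "x \<in> span (set vs)" for x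
  proof -
    have "x \<in> span_list us"
      using that us span_list_as_span by metis
    then obtain f where x: "x = lincomb_list f us"
      unfolding span_list_def by blast
    have "x $ i = (\<Sum>l<r. (f l * d l) * u l $ i)" if i: "i < N" for i
    proof -
      have "x $ i = (\<Sum>l<r. (f l \<cdot>\<^sub>v us ! l) $ i)"
        unfolding x lincomb_list_def using i us(3,4)
        by (subst sumlist_nth) (auto simp: atLeast0LessThan nth_mem subsetD)
      also have "\<dots> = (\<Sum>l<r. (f l * d l) * u l $ i)"
      proof (intro sum.cong refl)
        fix l assume "l \<in> {..<r}"
        then show "(f l \<cdot>\<^sub>v us ! l) $ i = (f l * d l) * u l $ i"
          using uc[of l] d0[of l] i by (simp add: u_def)
      qed
      finally show ?thesis .
    qed
    then show ?thesis
      by (intro exI[of _ "\<lambda>l. f l * d l"] allI impI)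
  qed
  moreover have "1 / d 0 \<noteq> 0 \<and> u 0 = (1 / d 0) \<cdot>\<^sub>v hd vs" if ne: "vs \<noteq> []"
  proof -
    obtain v vs' where v: "vs = v # vs'"
      using ne by (cases vs) auto
    have "hd us = v"
      unfolding us_def v by (rule gram_schmidt_hd) (use vs v in auto)
    moreover have "us \<noteq> []" "0 < r"
      using us(4) v by (auto simp: r_def)
    ultimately show ?thesis
      using d0[of 0] v by (simp add: u_def hd_conv_nth)
  qed
  ultimately show ?thesis
    unfolding r_def by blast
qed

text \<open>Take for \<open>u\<close> the orthonormalization of a maximal independent set of columns of \<open>B\<close>; the entries
  of \<open>w\<^sub>l\<close> are the conjugated coordinates of the columns along \<open>u\<^sub>l\<close>.\<close>

lemma rank_factorization:
  assumes B: "B \<in> carrier_mat N N"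
  shows "\<exists>u w. orthonormal_family N (vec_space.rank N B) u \<and> (\<forall>l. w l \<in> carrier_vec N) \<and>
    B = outer_sum N (vec_space.rank N B) u w"
proof -
  interpret cof_vec_space N "TYPE(complex)" .
  have cB: "set (cols B) \<subseteq> carrier_vec N"
    using B cols_dim by blast
  have "\<exists>S. finite S \<and> maximal S (\<lambda>T. T \<subseteq> set (cols B) \<and> lin_indpt T) \<and> {} \<subseteq> S"
    by (rule maximal_exists_superset[of "set (cols B)"]) (auto simp: lin_dep_def)
  then obtain S where S: "finite S" "maximal S (\<lambda>T. T \<subseteq> set (cols B) \<and> lin_indpt T)"
    by blast
  have rank: "rank B = card S"
    by (rule rank_card_indpt[OF B S(2)])
  have S': "S \<subseteq> set (cols B)" "lin_indpt S"
    using S(2) by (auto simp: maximal_def)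
  \<comment> \<open>A column outside the span could be added to the maximal independent set \<open>S\<close>.\<close>
  have span: "x \<in> span S" if x: "x \<in> set (cols B)" for x
  proof (rule ccontr)
    assume nx: "x \<notin> span S"
    have SC: "S \<subseteq> carrier_vec N" using S' cB by blast
    have "x \<notin> S" using nx in_own_span[OF SC] by blast
    moreover have "lin_indpt (S \<union> {x})"
      using lin_dep_iff_in_span[OF SC S'(2) _ \<open>x \<notin> S\<close>] nx x cB by auto
    ultimately show False
      using S(2) S'(1) x unfolding maximal_def by blast
  qed
  obtain vs where vs: "set vs = S" "distinct vs" "length vs = card S"
    using finite_distinct_list[OF S(1)] distinct_card by metis
  obtain u where u: "orthonormal_family N (rank B) u"
    and sp: "\<forall>x \<in> span S. \<exists>a. \<forall>i<N. x $ i = (\<Sum>l<rank B. a l * u l $ i)"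
    using exists_orthonormal_basis[of vs N] vs S' cB rank by auto
  have "\<forall>j. \<exists>a. j < N \<longrightarrow> (\<forall>i<N. col B j $ i = (\<Sum>l<rank B. a l * u l $ i))"
  proof
    fix j
    have "j < N \<longrightarrow> col B j \<in> span S"
      using span[of "col B j"] B by (auto simp: cols_def)
    then show "\<exists>a. j < N \<longrightarrow> (\<forall>i<N. col B j $ i = (\<Sum>l<rank B. a l * u l $ i))"
      using sp by blast
  qed
  then have "\<exists>a. \<forall>j. j < N \<longrightarrow> (\<forall>i<N. col B j $ i = (\<Sum>l<rank B. a j l * u l $ i))"
    by (rule choice)
  then obtain a where a: "col B j $ i = (\<Sum>l<rank B. a j l * u l $ i)" if "i < N" "j < N" for i j
    by blast
  define w where "w l = vec N (\<lambda>j. cnj (a j l))" for l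
  have "B = outer_sum N (rank B) u w"
    by (rule eq_matI) (use B a in \<open>auto simp: w_def mult.commute\<close>)
  then show ?thesis
    using u by (intro exI[of _ u] exI[of _ w]) (auto simp: w_def)
qed

lemma frob_inner_le_op_norm_rank:
  assumes "D \<in> carrier_mat N N" "B \<in> carrier_mat N N"
  shows "frob_inner D B \<le> op_norm D * sqrt (real (vec_space.rank N B)) * sqrt (frob_norm_sq B)"
  using rank_factorization[OF assms(2)] frob_inner_outer_sum_le[OF assms(1)] by metis


section \<open>Unitary diagonalisation of Hermitian matrices\<close>

definition unitary :: "nat \<Rightarrow> complex mat \<Rightarrow> bool" where
  "unitary N U \<longleftrightarrow> U \<in> carrier_mat N N \<and> mat_adjoint U * U = 1\<^sub>m N"

lemma unitary_right_inverse:
  assumes "unitary N U"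
  shows "U * mat_adjoint U = 1\<^sub>m N"
  using assms mat_mult_left_right_inverse[of "mat_adjoint U" N U] by (simp add: unitary_def)

lemma unitary_mult:
  assumes "unitary N U" "unitary N V"
  shows "unitary N (U * V)"
proof -
  have c: "U \<in> carrier_mat N N" "V \<in> carrier_mat N N"
    using assms by (simp_all add: unitary_def)
  have "mat_adjoint (U * V) * (U * V) = mat_adjoint V * (mat_adjoint U * U) * V"
    using c by (simp add: mat_adjoint_mult[OF c] assoc_mult_mat[of _ N N _ N _ N] mult_carrier_mat[of _ N N _ N])
  then show ?thesis
    using assms c by (simp add: unitary_def)
qed

lemma unitary_of_orthonormal_family:
  assumes "orthonormal_family N N u"
  shows "unitary N (mat N N (\<lambda>(i, j). u j $ i))"
  unfolding unitary_def
proof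
  have "cnj (\<Sum>i<N. u j $ i * cnj (u k $ i)) = of_bool (j = k)" if "j < N" "k < N" for j k
    using assms that by (simp add: orthonormal_family_def del: cnj_sum)
  then show "mat_adjoint (mat N N (\<lambda>(i, j). u j $ i)) * mat N N (\<lambda>(i, j). u j $ i) = 1\<^sub>m N"
    by (intro eq_matI) (auto simp: scalar_prod_def atLeast0LessThan)
qed simp

lemma exists_unitary_first_column:
  assumes v: "v \<in> carrier_vec N" "v \<noteq> 0\<^sub>v N"
  shows "\<exists>W c. unitary N W \<and> c \<noteq> 0 \<and> col W 0 = c \<cdot>\<^sub>v v"
proof -
  interpret cof_vec_space N "TYPE(complex)" .
  note b = basis_completion[OF v]
  have N: "0 < N"
    using v by (cases N) auto
  then have ne: "basis_completion v \<noteq> []"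
    using b(6) by auto
  obtain u c where u: "orthonormal_family N N u" and c: "c \<noteq> 0" "u 0 = c \<cdot>\<^sub>v v"
    using exists_orthonormal_basis[OF b(2,4,5)] b(6,7) ne by metis
  have "col (mat N N (\<lambda>(i, j). u j $ i)) 0 = u 0"
    using N u by (intro eq_vecI) (auto simp: orthonormal_family_def)
  then show ?thesis
    using unitary_of_orthonormal_family[OF u] c by metis
qed

definition diag_of :: "complex list \<Rightarrow> complex mat" where
  "diag_of es = mat (length es) (length es) (\<lambda>(i, j). if i = j then es ! i else 0)"

lemma diag_of_Cons:
  "diag_of (e # es) = four_block_mat (mat 1 1 (\<lambda>_. e)) (0\<^sub>m 1 (length es)) (0\<^sub>m (length es) 1) (diag_of es)"
  by (rule eq_matI) (auto simp: diag_of_def nth_Cons')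

lemma hermitian_conjugate:
  assumes "A \<in> carrier_mat N N" "hermitian A" "W \<in> carrier_mat N N"
  shows "hermitian (mat_adjoint W * A * W)"
  using assms unfolding hermitian_def
  by (simp add: mat_adjoint_mult[of _ N N _ N] assoc_mult_mat[of _ N N _ N _ N] mult_carrier_mat[of _ N N _ N])

text \<open>In an orthonormal basis that starts with an eigenvector for \<open>e\<close>, the first column of the matrix
  is \<open>e\<close> times the first unit vector; since the matrix stays Hermitian, so is its first row. The
  remaining block carries the rest of the characteristic polynomial.\<close>

lemma hermitian_deflate:
  assumes A: "A \<in> carrier_mat (Suc n) (Suc n)" and h: "hermitian A"
    and cp: "char_poly A = [:-e, 1:] * p"
  shows "\<exists>W A3. unitary (Suc n) W \<and> A3 \<in> carrier_mat n n \<and> hermitian A3 \<and> char_poly A3 = p \<and>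
    mat_adjoint W * A * W = four_block_mat (mat 1 1 (\<lambda>_. e)) (0\<^sub>m 1 n) (0\<^sub>m n 1) A3"
proof -
  let ?N = "Suc n"
  have "eigenvalue A e"
    unfolding eigenvalue_root_char_poly[OF A] cp by simp
  then obtain v where v: "v \<in> carrier_vec ?N" "v \<noteq> 0\<^sub>v ?N" "A *\<^sub>v v = e \<cdot>\<^sub>v v"
    using A unfolding eigenvalue_def eigenvector_def by auto
  obtain W c where W: "unitary ?N W" and c: "c \<noteq> 0" "col W 0 = c \<cdot>\<^sub>v v"
    using exists_unitary_first_column[OF v(1,2)] by blast
  have Wc: "W \<in> carrier_mat ?N ?N" and WW: "mat_adjoint W * W = 1\<^sub>m ?N"
    using W by (simp_all add: unitary_def)
  define B where "B = mat_adjoint W * A * W"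
  have Bc: "B \<in> carrier_mat ?N ?N"
    using Wc A unfolding B_def by (intro mult_carrier_mat[of _ _ ?N]) auto
  have Bh: "hermitian B"
    unfolding B_def by (rule hermitian_conjugate[OF A h Wc])
  have "col B 0 = (mat_adjoint W * A) *\<^sub>v col W 0"
    using Wc A unfolding B_def by (intro col_mult2[of _ ?N ?N _ ?N]) auto
  also have "\<dots> = mat_adjoint W *\<^sub>v (A *\<^sub>v (c \<cdot>\<^sub>v v))"
    using Wc A v(1) c(2) by (simp add: assoc_mult_mat_vec[of _ ?N ?N _ ?N])
  also have "A *\<^sub>v (c \<cdot>\<^sub>v v) = e \<cdot>\<^sub>v col W 0"
    using A v c(2) by (simp add: mult_mat_vec smult_smult_assoc mult.commute)
  also have "mat_adjoint W *\<^sub>v (e \<cdot>\<^sub>v col W 0) = e \<cdot>\<^sub>v (mat_adjoint W *\<^sub>v col W 0)"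
    using Wc col_dim[of W 0] by (intro mult_mat_vec[of _ ?N ?N]) auto
  also have "mat_adjoint W *\<^sub>v col W 0 = col (mat_adjoint W * W) 0"
    using Wc by (intro col_mult2[symmetric, of _ ?N ?N _ ?N]) auto
  finally have colB: "col B 0 = e \<cdot>\<^sub>v col (1\<^sub>m ?N) 0"
    by (simp only: WW)
  have B0: "B $$ (i, 0) = (if i = 0 then e else 0)" if "i < ?N" for i
    using arg_cong[OF colB, of "\<lambda>x. x $ i"] that Bc by auto
  have B1: "B $$ (0, j) = (if j = 0 then e else 0)" if "j < ?N" for j
  proof (cases "j = 0")
    case False
    have "B $$ (0, j) = cnj (B $$ (j, 0))"
      using Bh that unfolding hermitian_index[OF Bc] by blast
    then show ?thesis
      using B0[OF that] False by simp
  qed (use B0[of 0] in simp)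
  define A3 where "A3 = mat n n (\<lambda>(i, j). B $$ (Suc i, Suc j))"
  have A3c: "A3 \<in> carrier_mat n n"
    by (simp add: A3_def)
  have block: "B = four_block_mat (mat 1 1 (\<lambda>_. e)) (0\<^sub>m 1 n) (0\<^sub>m n 1) A3"
    by (rule eq_matI) (use Bc B0 B1 in \<open>auto simp: A3_def\<close>)
  have "hermitian A3"
    unfolding hermitian_index[OF A3c]
  proof (intro allI impI)
    fix i j assume ij: "i < n" "j < n"
    then have "B $$ (Suc i, Suc j) = cnj (B $$ (Suc j, Suc i))"
      using Bh unfolding hermitian_index[OF Bc] by blast
    moreover have "A3 $$ (i, j) = B $$ (Suc i, Suc j)" "A3 $$ (j, i) = B $$ (Suc j, Suc i)"
      using ij by (simp_all add: A3_def)
    ultimately show "A3 $$ (i, j) = cnj (A3 $$ (j, i))"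
      by (simp only:)
  qed
  moreover have "char_poly A3 = p"
  proof -
    have "similar_mat B A"
      unfolding B_def by (rule similar_matI[of _ _ "mat_adjoint W" W ?N])
        (use A Wc WW unitary_right_inverse[OF W] in auto)
    then have "char_poly B = [:-e, 1:] * p"
      using cp char_poly_similar by metis
    moreover have "char_poly B = char_poly (mat 1 1 (\<lambda>_. e)) * char_poly A3"
      unfolding block by (rule char_poly_four_block_zeros_col) (auto simp: A3_def)
    moreover have "char_poly (mat 1 1 (\<lambda>_. e)) = [:-e, 1:]"
      by (simp add: char_poly_defs det_def sign_def)
    ultimately show ?thesis
      by (metis mult_cancel_left pCons_eq_0_iff zero_neq_one)
  qed
  ultimately show ?thesis
    using W A3c block B_def by metis
qed

text \<open>Deflating one eigenvalue at a time puts the eigenvalues on the diagonal in the prescribed order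
  and with the prescribed multiplicities.\<close>

lemma hermitian_unitary_diagonalisation:
  assumes "A \<in> carrier_mat (length es) (length es)" "hermitian A"
    and "char_poly A = (\<Prod>e\<leftarrow>es. [:-e, 1:])"
  shows "\<exists>U. unitary (length es) U \<and> mat_adjoint U * A * U = diag_of es"
  using assms
proof (induction es arbitrary: A)
  case Nil
  then show ?case
    by (intro exI[of _ "1\<^sub>m 0"]) (auto simp: unitary_def diag_of_def)
next
  case (Cons e es)
  let ?n = "length es"
  let ?N = "Suc ?n"
  let ?Z = "0\<^sub>m 1 ?n :: complex mat" and ?Z' = "0\<^sub>m ?n 1 :: complex mat"
  let ?E = "mat 1 1 (\<lambda>_. e)"
  have A: "A \<in> carrier_mat ?N ?N"
    using Cons.prems by simp
  obtain W A3 where W: "unitary ?N W" and A3: "A3 \<in> carrier_mat ?n ?n" "hermitian A3"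
    "char_poly A3 = (\<Prod>e\<leftarrow>es. [:-e, 1:])" and block: "mat_adjoint W * A * W = four_block_mat ?E ?Z ?Z' A3"
    using hermitian_deflate[OF A Cons.prems(2), of e "\<Prod>e\<leftarrow>es. [:-e, 1:]"] Cons.prems(3) by auto
  obtain V where V: "unitary ?n V" "mat_adjoint V * A3 * V = diag_of es"
    using Cons.IH[OF A3] by blast
  have Wc: "W \<in> carrier_mat ?N ?N" and Vc: "V \<in> carrier_mat ?n ?n"
    and VV: "mat_adjoint V * V = 1\<^sub>m ?n"
    using W V by (simp_all add: unitary_def)
  define Q where "Q = four_block_mat (1\<^sub>m 1) ?Z ?Z' V"
  have Qc: "Q \<in> carrier_mat ?N ?N"
    using Vc by (auto simp: Q_def)
  have adj: "mat_adjoint (1\<^sub>m 1 :: complex mat) = 1\<^sub>m 1" "mat_adjoint ?Z = ?Z'" "mat_adjoint ?Z' = ?Z"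
    by (auto intro!: eq_matI)
  have Qa: "mat_adjoint Q = four_block_mat (1\<^sub>m 1) ?Z ?Z' (mat_adjoint V)"
    unfolding Q_def by (subst mat_adjoint_four_block[of _ 1 1 _ ?n _ ?n]) (use Vc adj in auto)
  have mult: "four_block_mat X ?Z ?Z' Y * four_block_mat X' ?Z ?Z' Y' = four_block_mat (X * X') ?Z ?Z' (Y * Y')"
    if "X \<in> carrier_mat 1 1" "X' \<in> carrier_mat 1 1" "Y \<in> carrier_mat ?n ?n" "Y' \<in> carrier_mat ?n ?n"
    for X X' Y Y' :: "complex mat"
    by (subst mult_four_block_mat[of _ 1 1 _ ?n _ ?n _ _ 1 _ ?n]) (use that in auto)
  have "mat_adjoint Q * Q = four_block_mat (1\<^sub>m 1) ?Z ?Z' (1\<^sub>m ?n)"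
    unfolding Qa unfolding Q_def by (subst mult) (use Vc VV in auto)
  also have "\<dots> = 1\<^sub>m ?N"
    by (rule eq_matI) auto
  finally have Q: "unitary ?N Q"
    using Qc by (simp add: unitary_def)
  have "mat_adjoint (W * Q) * A * (W * Q) = mat_adjoint Q * (mat_adjoint W * A * W) * Q"
    using Wc Qc A by (simp add: mat_adjoint_mult[OF Wc Qc] assoc_mult_mat[of _ ?N ?N _ ?N _ ?N]
        mult_carrier_mat[of _ ?N ?N _ ?N])
  also have "\<dots> = four_block_mat ?E ?Z ?Z' (mat_adjoint V * A3 * V)"
    unfolding block Qa unfolding Q_def
    using Vc A3 by (simp add: mult mult_carrier_mat[of _ ?n ?n _ ?n] del: One_nat_def)
  also have "\<dots> = diag_of (e # es)"
    by (simp add: V(2) diag_of_Cons)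
  finally show ?case
    using unitary_mult[OF W Q] by auto
qed

text \<open>The indices of \<open>lam\<close> start at 1 and those of the eigenvectors at 0, hence the shift.\<close>

lemma hermitian_spectral_decomposition:
  assumes A: "A \<in> carrier_mat N N" "hermitian A"
    and cp: "char_poly A = (\<Prod>j = 1..N. [:- complex_of_real (lam j), 1:])"
  shows "\<exists>u. orthonormal_family N N u \<and>
    A = outer_sum N N u (\<lambda>l. complex_of_real (lam (Suc l)) \<cdot>\<^sub>v u l)"
proof -
  define es where "es = map (\<lambda>l. complex_of_real (lam (Suc l))) [0..<N]"
  have len: "length es = N"
    by (simp add: es_def)
  have "(\<Prod>e\<leftarrow>es. [:-e, 1:]) = (\<Prod>l<N. [:- complex_of_real (lam (Suc l)), 1:])"
    by (simp add: es_def prod.list_conv_set_nth atLeast0LessThan)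
  also have "\<dots> = char_poly A"
    unfolding cp by (rule prod.reindex_bij_witness[of _ "\<lambda>j. j - 1" Suc]) auto
  finally obtain U where U: "unitary N U" "mat_adjoint U * A * U = diag_of es"
    using hermitian_unitary_diagonalisation[of A es] A len by auto
  have Uc: "U \<in> carrier_mat N N" and UU: "mat_adjoint U * U = 1\<^sub>m N" and UU': "U * mat_adjoint U = 1\<^sub>m N"
    using U unitary_right_inverse by (auto simp: unitary_def)
  have D: "diag_of es \<in> carrier_mat N N"
    by (simp add: diag_of_def len)
  have orth: "orthonormal_family N N (col U)"
    unfolding orthonormal_family_def
  proof (intro conjI allI impI)
    fix l m assume lm: "l < N" "m < N"
    have "(\<Sum>i<N. col U l $ i * cnj (col U m $ i)) = (mat_adjoint U * U) $$ (m, l)"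
      using lm Uc by (auto simp: scalar_prod_def atLeast0LessThan mult.commute intro!: sum.cong)
    then show "(\<Sum>i<N. col U l $ i * cnj (col U m $ i)) = of_bool (l = m)"
      using lm by (simp add: UU)
  qed (use Uc in auto)
  have "A = (U * mat_adjoint U) * A * (U * mat_adjoint U)"
    using A by (simp add: UU')
  also have "\<dots> = U * (mat_adjoint U * A * U) * mat_adjoint U"
    using A Uc by (simp add: assoc_mult_mat[of _ N N _ N _ N] mult_carrier_mat[of _ N N _ N])
  finally have A_eq: "A = U * diag_of es * mat_adjoint U"
    by (simp only: U(2))
  have "A = outer_sum N N (col U) (\<lambda>l. complex_of_real (lam (Suc l)) \<cdot>\<^sub>v col U l)"
  proof (rule eq_matI)
    fix i j assume "i < dim_row (outer_sum N N (col U) (\<lambda>l. complex_of_real (lam (Suc l)) \<cdot>\<^sub>v col U l))"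
      "j < dim_col (outer_sum N N (col U) (\<lambda>l. complex_of_real (lam (Suc l)) \<cdot>\<^sub>v col U l))"
    then have ij: "i < N" "j < N" by simp_all
    have UD: "(U * diag_of es) $$ (i, l) = U $$ (i, l) * complex_of_real (lam (Suc l))" if "l < N" for l
    proof -
      have "(U * diag_of es) $$ (i, l) = (\<Sum>k<N. U $$ (i, k) * (if k = l then es ! k else 0))"
        using ij that Uc D by (auto simp: scalar_prod_def atLeast0LessThan diag_of_def len intro!: sum.cong)
      also have "\<dots> = U $$ (i, l) * es ! l"
        using that by (simp add: if_distrib sum.delta cong: if_cong)
      finally show ?thesis
        using that by (simp add: es_def)
    qed
    have "(X * mat_adjoint U) $$ (i, j) = (\<Sum>l<N. X $$ (i, l) * mat_adjoint U $$ (l, j))"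
      if "X \<in> carrier_mat N N" for X
      using that ij Uc by (auto simp: scalar_prod_def atLeast0LessThan intro!: sum.cong)
    from this[OF mult_carrier_mat[OF Uc D]]
    have "A $$ (i, j) = (\<Sum>l<N. (U * diag_of es) $$ (i, l) * mat_adjoint U $$ (l, j))"
      by (simp only: A_eq[symmetric])
    also have "\<dots> = outer_sum N N (col U) (\<lambda>l. complex_of_real (lam (Suc l)) \<cdot>\<^sub>v col U l) $$ (i, j)"
      using ij Uc by (auto simp: UD intro!: sum.cong)
    finally show "A $$ (i, j) = outer_sum N N (col U) (\<lambda>l. complex_of_real (lam (Suc l)) \<cdot>\<^sub>v col U l) $$ (i, j)" .
  qed (use A in auto)
  then show ?thesis
    using orth by blast
qed


section \<open>Low-rank approximation and the oracle inequality\<close>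

text \<open>Subadditivity of the rank, once the sign is moved into the second factors of a rank
  factorization of \<open>B\<close>.\<close>

lemma rank_minus_le:
  fixes A B :: "complex mat"
  assumes A: "A \<in> carrier_mat N N" and B: "B \<in> carrier_mat N N"
  shows "vec_space.rank N (A - B) \<le> vec_space.rank N A + vec_space.rank N B"
proof -
  obtain u w where w: "\<forall>l. w l \<in> carrier_vec N" and B_eq: "B = outer_sum N (vec_space.rank N B) u w"
    using rank_factorization[OF B] by blast
  define C where "C = outer_sum N (vec_space.rank N B) u (\<lambda>l. - w l)"
  have "B $$ (i, j) = (\<Sum>l<vec_space.rank N B. u l $ i * cnj (w l $ j))" if "i < N" "j < N" for i j
    using B_eq outer_sum_index[OF that] by metis
  moreover have "j < dim_vec (w l)" if "j < N" for j l
    using w that by (metis carrier_vecD)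
  ultimately have "A - B = A + C"
    by (intro eq_matI) (use A B in \<open>auto simp: C_def sum_negf\<close>)
  also have "vec_space.rank N (A + C) \<le> vec_space.rank N A + vec_space.rank N C"
    by (rule vec_space.rank_subadditive[OF A]) (simp add: C_def)
  also have "vec_space.rank N C \<le> vec_space.rank N B"
    unfolding C_def by (rule rank_outer_sum_le)
  finally show ?thesis by simp
qed

text \<open>The witness keeps the first \<open>k\<close> terms of the spectral decomposition. What is left is a sum of
  rank-one matrices over the eigenvectors from index \<open>k\<close> on, whose Frobenius norm is read off
  from \<open>frob_norm_sq_outer_sum\<close>.\<close>

lemma hermitian_low_rank_approximation:
  assumes A: "A \<in> carrier_mat N N" "hermitian A"
    and cp: "char_poly A = (\<Prod>j = 1..N. [:- complex_of_real (lam j), 1:])"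
    and k: "k \<le> N"
  shows "\<exists>S \<in> carrier_mat N N. hermitian S \<and> vec_space.rank N S \<le> k \<and>
    frob_norm_sq (S - A) = (\<Sum>j \<in> {k<..N}. (lam j)\<^sup>2)"
proof -
  obtain u where u: "orthonormal_family N N u"
    and A_eq: "A = outer_sum N N u (\<lambda>l. complex_of_real (lam (Suc l)) \<cdot>\<^sub>v u l)"
    using hermitian_spectral_decomposition[OF A cp] by blast
  have uc: "u l \<in> carrier_vec N" if "l < N" for l
    using u that by (simp add: orthonormal_family_def)
  have ud: "dim_vec (u l) = N" if "l < N" for l
    using uc[OF that] by simp
  define S where "S = outer_sum N k u (\<lambda>l. complex_of_real (lam (Suc l)) \<cdot>\<^sub>v u l)"
  have Sc: "S \<in> carrier_mat N N"
    by (simp add: S_def)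
  have S_index: "S $$ (i, j) = (\<Sum>l<k. complex_of_real (lam (Suc l)) * (u l $ i * cnj (u l $ j)))"
    if "i < N" "j < N" for i j
    unfolding S_def outer_sum_index[OF that] by (rule sum.cong) (use that k ud in auto)
  have "hermitian S"
    unfolding hermitian_index[OF Sc] by (auto simp: S_index mult_ac)
  moreover have "vec_space.rank N S \<le> k"
    unfolding S_def by (rule rank_outer_sum_le)
  moreover have "frob_norm_sq (S - A) = (\<Sum>j \<in> {k<..N}. (lam j)\<^sup>2)"
  proof -
    let ?u = "\<lambda>l. u (k + l)" and ?w = "\<lambda>l. complex_of_real (- lam (Suc (k + l))) \<cdot>\<^sub>v u (k + l)"
    have "S - A = outer_sum N (N - k) ?u ?w"
    proof (rule eq_matI)
      fix i j assume "i < dim_row (outer_sum N (N - k) ?u ?w)" "j < dim_col (outer_sum N (N - k) ?u ?w)"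
      then have ij: "i < N" "j < N" by simp_all
      let ?t = "\<lambda>l. complex_of_real (lam (Suc l)) * (u l $ i * cnj (u l $ j))"
      have "A $$ (i, j) = (\<Sum>l<N. u l $ i * cnj ((complex_of_real (lam (Suc l)) \<cdot>\<^sub>v u l) $ j))"
        using A_eq outer_sum_index[OF ij] by metis
      also have "\<dots> = (\<Sum>l<N. ?t l)"
        by (rule sum.cong) (use ij ud in auto)
      also have "\<dots> = (\<Sum>l<k. ?t l) + (\<Sum>l \<in> {k..<N}. ?t l)"
        using k by (subst sum.union_disjoint[symmetric]) (auto intro!: sum.cong)
      also have "(\<Sum>l \<in> {k..<N}. ?t l) = (\<Sum>l<N - k. ?t (k + l))"
        by (rule sum.reindex_bij_witness[of _ "\<lambda>l. k + l" "\<lambda>l. l - k"]) auto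
      finally have "(S - A) $$ (i, j) = - (\<Sum>l<N - k. ?t (k + l))"
        using ij A Sc by (simp add: S_index)
      also have "\<dots> = outer_sum N (N - k) ?u ?w $$ (i, j)"
        unfolding outer_sum_index[OF ij] sum_negf[symmetric]
        by (rule sum.cong) (use ij ud in auto)
      finally show "(S - A) $$ (i, j) = outer_sum N (N - k) ?u ?w $$ (i, j)" .
    qed (use A Sc in auto)
    moreover have "orthonormal_family N (N - k) ?u"
      using u by (simp add: orthonormal_family_def)
    ultimately have "frob_norm_sq (S - A) = (\<Sum>l<N - k. (cvec_norm (?w l))\<^sup>2)"
      by (simp add: frob_norm_sq_outer_sum uc)
    also have "\<dots> = (\<Sum>l<N - k. (lam (Suc (k + l)))\<^sup>2)"
    proof (rule sum.cong)
      fix l assume "l \<in> {..<N - k}"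
      then have "cvec_norm (u (k + l)) = 1"
        by (intro orthonormal_family_cvec_norm[OF u]) auto
      then show "(cvec_norm (?w l))\<^sup>2 = (lam (Suc (k + l)))\<^sup>2"
        unfolding cvec_norm_smult by simp
    qed simp
    also have "\<dots> = (\<Sum>j \<in> {k<..N}. (lam j)\<^sup>2)"
      by (rule sum.reindex_bij_witness[of _ "\<lambda>j. j - Suc k" "\<lambda>l. Suc (k + l)"]) auto
    finally show ?thesis .
  qed
  ultimately show ?thesis
    using Sc by blast
qed

text \<open>Here \<open>x\<close> and \<open>y\<close> stand for the Frobenius distances of estimator and competitor from the truth,
  \<open>r\<close> and \<open>k\<close> for their ranks and \<open>s\<close> for the operator norm of the error. With \<open>\<alpha> + \<beta> = 1 + \<theta>\<close>,
  the mixed terms cost \<open>(1 + \<theta>) s\<^sup>2 (r + k) \<le> \<nu> (r + k)\<close>, which turns the penalty difference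
  \<open>\<nu> (k - r)\<close> into \<open>2 \<nu> k\<close>. The split \<open>\<alpha> = 1 + \<theta>/2\<close>, \<open>\<beta> = \<theta>/2\<close> is the one for which
  \<open>1 - 1/\<alpha>\<close> and \<open>1 + 1/\<beta>\<close> are reciprocal, namely \<open>1/c\<close> and \<open>c\<close>.\<close>

lemma penalized_quadratic_bound:
  fixes x y s r k \<nu> \<theta> :: real
  assumes "0 \<le> r" "0 \<le> k" and \<theta>: "0 < \<theta>" and \<nu>: "(1 + \<theta>) * s\<^sup>2 \<le> \<nu>"
    and le: "x\<^sup>2 \<le> y\<^sup>2 + 2 * s * sqrt (r + k) * (x + y) + \<nu> * (k - r)"
  shows "x\<^sup>2 \<le> (c_factor \<theta>)\<^sup>2 * y\<^sup>2 + 2 * c_factor \<theta> * \<nu> * k"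
proof -
  define t where "t = s * sqrt (r + k)"
  define \<alpha> \<beta> c where "\<alpha> = 1 + \<theta> / 2" and "\<beta> = \<theta> / 2" and "c = c_factor \<theta>"
  have pos: "0 < \<alpha>" "0 < \<beta>" "0 < c"
    using \<theta> by (simp_all add: \<alpha>_def \<beta>_def c_def c_factor_def add_pos_pos)
  have young: "2 * t * z \<le> \<gamma> * t\<^sup>2 + z\<^sup>2 / \<gamma>" if "0 < \<gamma>" for z \<gamma>
  proof -
    have "0 \<le> (\<gamma> * t - z)\<^sup>2 / \<gamma>"
      using that by simp
    also have "\<dots> = \<gamma> * t\<^sup>2 + z\<^sup>2 / \<gamma> - 2 * t * z"
      using that by (simp add: power2_eq_square field_simps)
    finally show ?thesis by simp
  qed
  have "(\<alpha> + \<beta>) * t\<^sup>2 = (1 + \<theta>) * s\<^sup>2 * (r + k)"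
    using assms(1,2) by (simp add: \<alpha>_def \<beta>_def t_def power_mult_distrib)
  also have "\<dots> \<le> \<nu> * (r + k)"
    using \<nu> assms(1,2) by (intro mult_right_mono) auto
  finally have "\<alpha> * t\<^sup>2 + \<beta> * t\<^sup>2 \<le> \<nu> * (r + k)"
    by (simp add: distrib_right)
  moreover have "x\<^sup>2 \<le> y\<^sup>2 + 2 * t * x + 2 * t * y + \<nu> * (k - r)"
    using le by (simp add: t_def algebra_simps)
  ultimately have "x\<^sup>2 \<le> y\<^sup>2 + x\<^sup>2 / \<alpha> + y\<^sup>2 / \<beta> + \<nu> * (r + k) + \<nu> * (k - r)"
    using young[OF pos(1), of x] young[OF pos(2), of y] by linarith
  then have "x\<^sup>2 * (1 - 1 / \<alpha>) \<le> y\<^sup>2 * (1 + 1 / \<beta>) + 2 * \<nu> * k"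
    by (simp add: algebra_simps)
  moreover have "1 - 1 / \<alpha> = 1 / c" "1 + 1 / \<beta> = c"
    using \<theta> by (simp_all add: \<alpha>_def \<beta>_def c_def c_factor_def field_simps)
  ultimately have "x\<^sup>2 / c \<le> y\<^sup>2 * c + 2 * \<nu> * k"
    by simp
  then have "x\<^sup>2 \<le> (y\<^sup>2 * c + 2 * \<nu> * k) * c"
    using pos(3) by (simp add: pos_divide_le_eq)
  then show ?thesis
    by (simp add: c_def power2_eq_square algebra_simps)
qed

lemma rank_penalized_oracle_inequality:
  assumes A: "A \<in> carrier_mat N N" and \<rho>: "\<rho> \<in> carrier_mat N N"
    and S: "rank_penalized N \<nu> A S" and T: "T \<in> carrier_mat N N" "hermitian T"
    and \<theta>: "0 < \<theta>" and \<nu>: "(1 + \<theta>) * (op_norm (A - \<rho>))\<^sup>2 \<le> \<nu>"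
  shows "frob_norm_sq (S - \<rho>) \<le>
    (c_factor \<theta>)\<^sup>2 * frob_norm_sq (T - \<rho>) + 2 * c_factor \<theta> * \<nu> * real (vec_space.rank N T)"
proof -
  let ?rk = "vec_space.rank N"
  have Sc: "S \<in> carrier_mat N N"
    and min: "rank_criterion N \<nu> A S \<le> rank_criterion N \<nu> A T"
    using S T unfolding rank_penalized_def is_arg_min_linorder by blast+
  define D where "D = A - \<rho>"
  have D: "D \<in> carrier_mat N N"
    using \<rho> by (simp add: D_def minus_carrier_mat)
  have expand: "frob_norm_sq (X - A) =
      frob_norm_sq (X - \<rho>) - 2 * frob_inner D (X - \<rho>) + frob_norm_sq D" if X: "X \<in> carrier_mat N N" for X
  proof -
    have "X - A = (X - \<rho>) - D"
      by (rule eq_matI) (use X A \<rho> in \<open>auto simp: D_def\<close>)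
    then show ?thesis
      using frob_norm_sq_minus[of "X - \<rho>" N N D] minus_carrier_mat[OF \<rho>, of X] D by simp
  qed
  have diff: "S - T = (S - \<rho>) - (T - \<rho>)"
    by (rule eq_matI) (use Sc T \<rho> in auto)
  define x y where "x = sqrt (frob_norm_sq (S - \<rho>))" and "y = sqrt (frob_norm_sq (T - \<rho>))"
  have xy: "x\<^sup>2 = frob_norm_sq (S - \<rho>)" "y\<^sup>2 = frob_norm_sq (T - \<rho>)" "0 \<le> x" "0 \<le> y"
    by (simp_all add: x_def y_def)
  have "frob_inner D (S - T) \<le> op_norm D * sqrt (real (?rk (S - T))) * sqrt (frob_norm_sq (S - T))"
    by (rule frob_inner_le_op_norm_rank) (use D Sc T in auto)
  \<comment> \<open>The absolute value covers dimension 0, where \<open>op_norm\<close> is a supremum over the empty set.\<close>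
  also have "\<dots> \<le> \<bar>op_norm D\<bar> * sqrt (real (?rk S) + real (?rk T)) * (x + y)"
    unfolding diff x_def y_def
  proof (intro mult_mono)
    have "real (?rk (S - T)) \<le> real (?rk S) + real (?rk T)"
      using rank_minus_le[OF Sc T(1)] by linarith
    then show "sqrt (real (?rk (S - \<rho> - (T - \<rho>)))) \<le> sqrt (real (?rk S) + real (?rk T))"
      by (simp add: diff)
    show "sqrt (frob_norm_sq (S - \<rho> - (T - \<rho>))) \<le>
        sqrt (frob_norm_sq (S - \<rho>)) + sqrt (frob_norm_sq (T - \<rho>))"
      by (rule sqrt_frob_norm_sq_triangle[of _ N N]) (use Sc T \<rho> in auto)
  qed auto
  finally have inner: "frob_inner D (S - T) \<le> \<bar>op_norm D\<bar> * sqrt (real (?rk S) + real (?rk T)) * (x + y)" .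
  have "frob_inner D (S - T) = frob_inner D (S - \<rho>) - frob_inner D (T - \<rho>)"
    unfolding diff by (rule frob_inner_minus_right[of _ N N]) (use D Sc T \<rho> in auto)
  moreover have "frob_norm_sq (S - A) + \<nu> * real (?rk S) \<le> frob_norm_sq (T - A) + \<nu> * real (?rk T)"
    using min by (simp add: rank_criterion_def)
  ultimately have "x\<^sup>2 \<le> y\<^sup>2 + 2 * \<bar>op_norm D\<bar> * sqrt (real (?rk S) + real (?rk T)) * (x + y)
      + \<nu> * (real (?rk T) - real (?rk S))"
    using inner unfolding expand[OF Sc] expand[OF T(1)] xy by (simp add: algebra_simps)
  from penalized_quadratic_bound[OF _ _ \<theta> _ this] show ?thesis
    using \<nu> by (simp add: xy D_def)
qed

theorem theorem4:
  fixes n m :: nat and \<rho> :: "complex mat" and lam :: "nat \<Rightarrow> real"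
    and M :: "'w measure" and R :: "pauli list \<Rightarrow> nat \<Rightarrow> 'w \<Rightarrow> int list"
    and \<nu> \<theta> :: real and rho_hat rho_nu :: "'w \<Rightarrow> complex mat"
  assumes "1 \<le> n" and "1 \<le> m"
    and "density_matrix (2 ^ n) \<rho>"
    and "ordered_eigenvalues (2 ^ n) \<rho> lam"
    and "prob_space M"
    and "pauli_data M n m \<rho> R"
    and "\<And>\<omega>. \<omega> \<in> space M \<Longrightarrow> rho_hat \<omega> = lin_est n m (\<lambda>a i. R a i \<omega>)"
    and "\<nu> > 0"
    and "\<And>\<omega>. \<omega> \<in> space M \<Longrightarrow> rank_penalized (2 ^ n) \<nu> (rho_hat \<omega>) (rho_nu \<omega>)"
    and "\<theta> > 0"
  shows "\<forall>\<omega> \<in> space M. \<nu> \<ge> (1 + \<theta>) * (op_norm (rho_hat \<omega> - \<rho>))\<^sup>2 \<longrightarrow>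
           frob_norm_sq (rho_nu \<omega> - \<rho>) \<le>
             (MIN k \<in> {1..2 ^ n}. (c_factor \<theta>)\<^sup>2 * (\<Sum>j \<in> {k<..2 ^ n}. (lam j)\<^sup>2)
                + 2 * c_factor \<theta> * \<nu> * real k)"
proof (intro ballI impI)
  fix \<omega> assume \<omega>: "\<omega> \<in> space M" and ev: "(1 + \<theta>) * (op_norm (rho_hat \<omega> - \<rho>))\<^sup>2 \<le> \<nu>"
  let ?N = "2 ^ n :: nat"
  have \<rho>: "\<rho> \<in> carrier_mat ?N ?N" "hermitian \<rho>"
    using assms(3) by (simp_all add: density_matrix_def)
  have A: "rho_hat \<omega> \<in> carrier_mat ?N ?N"
    using assms(7)[OF \<omega>] by (simp add: lin_est_def)
  have bound: "frob_norm_sq (rho_nu \<omega> - \<rho>) \<le> (c_factor \<theta>)\<^sup>2 * (\<Sum>j \<in> {k<..?N}. (lam j)\<^sup>2)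
      + 2 * c_factor \<theta> * \<nu> * real k" if "k \<le> ?N" for k
  proof -
    obtain T where T: "T \<in> carrier_mat ?N ?N" "hermitian T" "vec_space.rank ?N T \<le> k"
      "frob_norm_sq (T - \<rho>) = (\<Sum>j \<in> {k<..?N}. (lam j)\<^sup>2)"
      using hermitian_low_rank_approximation[OF \<rho> _ \<open>k \<le> ?N\<close>] assms(4)
      unfolding ordered_eigenvalues_def by blast
    have "2 * c_factor \<theta> * \<nu> * real (vec_space.rank ?N T) \<le> 2 * c_factor \<theta> * \<nu> * real k"
      using T(3) assms(8,10) by (intro mult_left_mono) (auto simp: c_factor_def)
    then show ?thesis
      using rank_penalized_oracle_inequality[OF A \<rho>(1) assms(9)[OF \<omega>] T(1,2) assms(10) ev] unfolding T(4)
      by linarith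
  qed
  show "frob_norm_sq (rho_nu \<omega> - \<rho>) \<le>
      (MIN k \<in> {1..?N}. (c_factor \<theta>)\<^sup>2 * (\<Sum>j \<in> {k<..?N}. (lam j)\<^sup>2)
         + 2 * c_factor \<theta> * \<nu> * real k)"
    by (subst Min_ge_iff) (auto intro: bound)
qed

end
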